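(* Suppose outcomes and treatments are generated by $$Y_i=g_n(i,\bm{D},\bm{X},\bm{A},\bm{\varepsilon}),\qquad D_i=h_n(i,\bm{X},\bm{A},\bm{\nu}),\qquad i\in\mathcal{N}_n,$$ with controls $\mathcal{C}_i=(\bm{X},\bm{A})$ for all $i\in\mathcal{N}_n$. Let $f$ be a $K$-neighborhood exposure mapping, let $t,t'$ be exposure values, and suppose the overlap condition holds: for every $i\in\mathcal{N}_n$, every $c$ in the support of $\mathcal{C}_i$ and every $s\in\{t,t'\}$, the conditional distribution of $\bm{D}$ given $T_i=s,\ \mathcal{C}_i=c$ exists. Assume: (1) (Unconfoundedness) for all $i\in\mathcal{N}_n$, $Y_i(\cdot)$ is independent of $\bm{D}$ conditional on $\mathcal{C}_i$; (2) (Approximate neighborhood interference) there exists $\gamma:\mathbb{R}_+\to\mathbb{R}_+$ with $\gamma(s)\to0$ as $s\to\infty$ such that, for all $s$, $$\max_{i\in\mathcal{N}_n}\mathbf{E}\big[\,|g_n(i,\bm{D},\bm{X},\bm{A},\bm{\varepsilon})-g_{|\mathcal{N}(i,s)|}(i,\bm{D}_{\mathcal{N}(i,s)},\bm{X}_{\mathcal{N}(i,s)},\bm{A}_{\mathcal{N}(i,s)},\bm{\varepsilon}_{\mathcal{N}(i,s)})|\ \big|\ \bm{D},\bm{X},\bm{A}\big]\le\gamma(s);$$ (3) ($t'$-degeneracy under the $K$-neighborhood model) for all $i\in\mathcal{N}_n$ there exists $\bm{\delta}_i\in\{0,1\}^{|\mathcal{N}(i,K)|}$ such that, for any $\bm{d}_{\mathcal{N}(i,K)}\in\{0,1\}^{|\mathcal{N}(i,K)|}$,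 $f(\bm{d}_{\mathcal{N}(i,K)})=t'$ implies $\tilde Y_i^K(\bm{d}_{\mathcal{N}(i,K)})=\tilde Y_i^K(\bm{\delta}_i)$ almost surely. Then $$|\tau(t,t')-\tau^*_K(t,t')|\le2\gamma(K),$$ where $$\tau^*_K(t,t')=\frac1n\sum_{i=1}^n\mathbf{E}\big[\tilde Y_i^K(\bm{D}_{\mathcal{N}(i,K)})-\tilde Y_i^K(\bm{\delta}_i)\mid T_i=t,\mathcal{C}_i\big],$$ and $2\gamma(K)\to0$ as $K\to\infty$.
   Context: There are $n$ units, $\mathcal{N}_n=\{1,\dots,n\}$. $\bm{D}=(D_i)_{i=1}^n\in\{0,1\}^n$ is the treatment assignment vector. $\bm{A}$ is a network ($n\times n$ binary matrix, conditioned upon), $\bm{X}=(X_i)_{i=1}^n$ unit-level observables, $\bm{\varepsilon}=(\varepsilon_i)_{i=1}^n$ outcome unobservables, $\bm{\nu}=(\nu_i)_{i=1}^n$ selection unobservables, and $\{(g_m,h_m)\}_{m\in\mathbb{N}}$ is a sequence of function pairs, indexed by the number $m$ of units in the model, with each $g_m$ taking values in $\mathbb{R}$ and each $h_m$ in $\{0,1\}$. Potential outcomes are $Y_i(\bm{d})=g_n(i,\bm{d},\bm{X},\bm{A},\bm{\varepsilon})$ for $\bm{d}\in\{0,1\}^n$, so $Y_i=Y_i(\bm{D})$. For $s\ge0$, $\mathcal{N}(i,s)$ is the set of units at path distance at most $s$ from $i$ in $\bm{A}$ (path distance is the length of a shortest path, $\infty$ if there is none, and $0$ from a unit to itself). For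 $S\subseteq\mathcal{N}_n$, $\bm{D}_S=(D_i)_{i\in S}$, $\bm{X}_S=(X_i)_{i\in S}$, $\bm{\varepsilon}_S=(\varepsilon_i)_{i\in S}$, and $\bm{A}_S=(A_{jk})_{j,k\in S}$ is the subnetwork on $S$. The quantity $g_{|\mathcal{N}(i,s)|}(i,\bm{D}_{\mathcal{N}(i,s)},\dots)$ is the outcome of unit $i$ in the counterfactual $s$-neighborhood model where only the units in $\mathcal{N}(i,s)$ are present; the potential outcome in the counterfactual $K$-neighborhood model is, for $\bm{d}_i\in\{0,1\}^{|\mathcal{N}(i,K)|}$, $$\tilde Y_i^K(\bm{d}_i)=g_{|\mathcal{N}(i,K)|}(i,\bm{d}_i,\bm{X}_{\mathcal{N}(i,K)},\bm{A}_{\mathcal{N}(i,K)},\bm{\varepsilon}_{\mathcal{N}(i,K)}).$$ An exposure mapping is a deterministic function $f:\mathcal{N}_n\times\{0,1\}^n\to\mathbb{R}^{d_t}$, with $T_i=f(i,\bm{D})$; it is a $K$-neighborhood exposure mapping if $f(i,\bm{d})=f(i,\bm{d}')$ for all $i$ and all $\bm{d},\bm{d}'$ agreeing on $\mathcal{N}(i,K)$, in which case one writes $f(\bm{d}_{\mathcal{N}(i,K)})$ for $f(i,\bm{d})$, where $\bm{d}_{\mathcal{N}(i,K)}=(d_j:j\in\mathcal{N}(i,K))$. The exposure contrast is $$\tau(t,t')=\frac1n\sum_{i=1}^n\big(\mathbf{E}[Y_i\mid T_i=t,\mathcal{C}_i]-\mathbf{E}[Y_i\mid T_i=t',\mathcal{C}_i]\big),$$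 where $\mathbf{E}[Y_i\mid T_i=t,\mathcal{C}_i]$ means $m_t(\mathcal{C}_i)$ with $m_t(c)=\mathbf{E}[Y_i\mid T_i=t,\mathcal{C}_i=c]$. All expectations are assumed to exist and be finite; (in)equalities between random quantities are almost sure.
   Formalization: Unconfoundedness is assumed also for the K-neighborhood potential outcomes (independent of D given C_i), not only for Y_i(·); with (1) for Y_i(·) alone the bound fails, e.g. empty network, K=0, D_i=ε_i a fair coin, g_2=0, g_1=ε_i·1{d_i=0}. *)

theory Defs
  imports "HOL-Probability.Probability"
begin

section \<open>Conditioning on random elements\<close>

definition sigma_gen :: "'w measure \<Rightarrow> 'c measure \<Rightarrow> ('w \<Rightarrow> 'c) \<Rightarrow> 'w measure" where
  "sigma_gen M N W = vimage_algebra (space M) W N"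

text \<open>
  \<open>cond_mean M N W Z w\<close> is \<open>E[Z | W = w]\<close>: the value at \<open>w\<close> of a fixed measurable factor through
  \<open>W\<close> of the conditional expectation of \<open>Z\<close> given the sigma-algebra of \<open>W\<close>. As usual it is
  determined up to null sets of the law of \<open>W\<close>; existence of the factor (Doob-Dynkin) is proved in
  \<open>cond_mean_AE\<close> below.
\<close>

definition cond_mean ::
  "'w measure \<Rightarrow> 'c measure \<Rightarrow> ('w \<Rightarrow> 'c) \<Rightarrow> ('w \<Rightarrow> real) \<Rightarrow> 'c \<Rightarrow> real" where
  "cond_mean M N W Z = (SOME m. m \<in> borel_measurable N \<and>
     (AE \<omega> in M. real_cond_exp M (sigma_gen M N W) Z \<omega> = m (W \<omega>)))"

text \<open>Conditional independence of the random elements \<open>U\<close> and \<open>V\<close> given \<open>W\<close>.\<close>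

definition cond_indep ::
  "'w measure \<Rightarrow> 'u measure \<Rightarrow> ('w \<Rightarrow> 'u) \<Rightarrow> 'v measure \<Rightarrow> ('w \<Rightarrow> 'v) \<Rightarrow>
   'c measure \<Rightarrow> ('w \<Rightarrow> 'c) \<Rightarrow> bool" where
  "cond_indep M MU U MV V N W \<longleftrightarrow>
     (\<forall>B\<in>sets MU. \<forall>B'\<in>sets MV. AE \<omega> in M.
        real_cond_exp M (sigma_gen M N W) (\<lambda>\<omega>'. indicator B (U \<omega>') * indicator B' (V \<omega>')) \<omega>
        = real_cond_exp M (sigma_gen M N W) (\<lambda>\<omega>'. indicator B (U \<omega>')) \<omega>
          * real_cond_exp M (sigma_gen M N W) (\<lambda>\<omega>'. indicator B' (V \<omega>')) \<omega>)"

lemma doob_dynkin_nonneg: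
  fixes u :: "'w \<Rightarrow> real"
  assumes W: "W \<in> X \<rightarrow> space N"
    and u: "u \<in> borel_measurable (vimage_algebra X W N)" "\<And>x. 0 \<le> u x"
  shows "\<exists>m\<in>borel_measurable N. \<forall>x\<in>X. u x = m (W x)"
  using u
proof (induction rule: borel_measurable_induct_real)
  case (set A)
  then obtain B where B: "B \<in> sets N" "A = W -` B \<inter> X"
    using sets_vimage_algebra2[OF W] by auto
  then show ?case
    by (intro bexI[of _ "indicator B"]) (auto simp: indicator_def)
next
  case (mult u c)
  then obtain m where "m \<in> borel_measurable N" "\<forall>x\<in>X. u x = m (W x)" by blast
  then show ?case by (intro bexI[of _ "\<lambda>w. c * m w"]) auto
next
  case (add u v)
  then obtain m m' where "m \<in> borel_measurable N" "\<forall>x\<in>X. u x = m (W x)"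
    "m' \<in> borel_measurable N" "\<forall>x\<in>X. v x = m' (W x)" by blast
  then show ?case by (intro bexI[of _ "\<lambda>w. m' w + m w"]) auto
next
  case (seq U)
  then have "\<forall>i. \<exists>m. m \<in> borel_measurable N \<and> (\<forall>x\<in>X. U i x = m (W x))" by blast
  then obtain m where m [measurable]: "\<And>i. m i \<in> borel_measurable N"
    and mU: "\<And>i x. x \<in> X \<Longrightarrow> U i x = m i (W x)" by metis
  have "(\<lambda>w. lim (\<lambda>i. m i w)) \<in> borel_measurable N" by measurable
  moreover have "u x = lim (\<lambda>i. m i (W x))" if "x \<in> X" for x
  proof -
    have "(\<lambda>i. U i x) \<longlonglongrightarrow> u x" using seq that by simp
    then show ?thesis using mU[OF that] by (simp add: limI)
  qed
  ultimately show ?case by (intro bexI[of _ "\<lambda>w. lim (\<lambda>i. m i w)"]) auto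
qed

lemma cond_mean_AE:
  fixes Z :: "'w \<Rightarrow> real"
  assumes W: "W \<in> measurable M N"
  shows "cond_mean M N W Z \<in> borel_measurable N"
    and "AE \<omega> in M. real_cond_exp M (sigma_gen M N W) Z \<omega> = cond_mean M N W Z (W \<omega>)"
proof -
  let ?u = "real_cond_exp M (sigma_gen M N W) Z"
  have W': "W \<in> space M \<rightarrow> space N" using measurable_space[OF W] by auto
  have [measurable]: "?u \<in> borel_measurable (vimage_algebra (space M) W N)"
    using borel_measurable_cond_exp[of M "sigma_gen M N W" Z] by (simp add: sigma_gen_def)
  obtain p where p: "p \<in> borel_measurable N" "\<forall>x\<in>space M. max 0 (?u x) = p (W x)"
    using doob_dynkin_nonneg[OF W', of "\<lambda>x. max 0 (?u x)"] by auto
  obtain q where q: "q \<in> borel_measurable N" "\<forall>x\<in>space M. max 0 (- ?u x) = q (W x)"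
    using doob_dynkin_nonneg[OF W', of "\<lambda>x. max 0 (- ?u x)"] by auto
  have "?u x = p (W x) - q (W x)" if "x \<in> space M" for x
    using p(2) q(2) that by (auto dest!: bspec)
  then have "(\<lambda>w. p w - q w) \<in> borel_measurable N \<and> (AE \<omega> in M. ?u \<omega> = (\<lambda>w. p w - q w) (W \<omega>))"
    using p(1) q(1) by auto
  from someI[of "\<lambda>m. m \<in> borel_measurable N \<and> (AE \<omega> in M. ?u \<omega> = m (W \<omega>))", OF this]
  show "cond_mean M N W Z \<in> borel_measurable N"
    and "AE \<omega> in M. ?u \<omega> = cond_mean M N W Z (W \<omega>)"
    unfolding cond_mean_def by auto
qed


section \<open>Networks\<close>

text \<open>
  A network on the units \<open>{1..n}\<close> is a binary matrix \<open>A\<close>; symmetry is not required, so paths follow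
  the direction of the links.
\<close>

definition net_paths :: "nat \<Rightarrow> (nat \<Rightarrow> nat \<Rightarrow> bool) \<Rightarrow> nat \<Rightarrow> nat \<Rightarrow> nat list set" where
  "net_paths n A i j = {p. p \<noteq> [] \<and> hd p = i \<and> last p = j \<and> set p \<subseteq> {1..n} \<and> distinct p \<and>
     successively A p}"

definition path_dist :: "nat \<Rightarrow> (nat \<Rightarrow> nat \<Rightarrow> bool) \<Rightarrow> nat \<Rightarrow> nat \<Rightarrow> enat" where
  "path_dist n A i j = (INF p\<in>net_paths n A i j. enat (length p - 1))"

definition nbhd :: "nat \<Rightarrow> (nat \<Rightarrow> nat \<Rightarrow> bool) \<Rightarrow> nat \<Rightarrow> real \<Rightarrow> nat set" where
  "nbhd n A i s = {j\<in>{1..n}. ereal_of_enat (path_dist n A i j) \<le> ereal s}"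

text \<open>Families indexed by \<open>S\<close> are functions that are extensional on \<open>S\<close>.\<close>

definition subnet :: "nat set \<Rightarrow> (nat \<Rightarrow> nat \<Rightarrow> bool) \<Rightarrow> nat \<Rightarrow> nat \<Rightarrow> bool" where
  "subnet S A = (\<lambda>j\<in>S. \<lambda>k\<in>S. A j k)"

abbreviation assignments :: "nat set \<Rightarrow> (nat \<Rightarrow> bool) set" where
  "assignments S \<equiv> S \<rightarrow>\<^sub>E UNIV"


section \<open>Potential outcomes, exposures and estimands\<close>

text \<open>
  The outcome of unit \<open>i\<close> in the model in which only the units in \<open>S\<close> are present. Units keep their
  labels in submodels. \<open>S = {1..n}\<close> gives \<open>Y_i(d)\<close> and \<open>S = nbhd n A i K\<close> gives the potential
  outcome of the \<open>K\<close>-neighborhood model.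
\<close>

definition pot_outcome ::
  "(nat \<Rightarrow> nat \<Rightarrow> (nat \<Rightarrow> bool) \<Rightarrow> (nat \<Rightarrow> 'x) \<Rightarrow> (nat \<Rightarrow> nat \<Rightarrow> bool) \<Rightarrow> (nat \<Rightarrow> 'e) \<Rightarrow> real) \<Rightarrow>
   (nat \<Rightarrow> 'w \<Rightarrow> 'x) \<Rightarrow> (nat \<Rightarrow> nat \<Rightarrow> bool) \<Rightarrow> (nat \<Rightarrow> 'w \<Rightarrow> 'e) \<Rightarrow>
   nat set \<Rightarrow> nat \<Rightarrow> (nat \<Rightarrow> bool) \<Rightarrow> 'w \<Rightarrow> real" where
  "pot_outcome g X A eps S i d \<omega> =
     g (card S) i (restrict d S) (\<lambda>j\<in>S. X j \<omega>) (subnet S A) (\<lambda>j\<in>S. eps j \<omega>)"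

definition controls ::
  "nat \<Rightarrow> (nat \<Rightarrow> 'w \<Rightarrow> 'x) \<Rightarrow> (nat \<Rightarrow> nat \<Rightarrow> bool) \<Rightarrow> 'w \<Rightarrow> (nat \<Rightarrow> 'x) \<times> (nat \<Rightarrow> nat \<Rightarrow> bool)" where
  "controls n X A \<omega> = (\<lambda>j\<in>{1..n}. X j \<omega>, subnet {1..n} A)"

definition controls_space :: "nat \<Rightarrow> 'x measure \<Rightarrow> ((nat \<Rightarrow> 'x) \<times> (nat \<Rightarrow> nat \<Rightarrow> bool)) measure" where
  "controls_space n MX = (\<Pi>\<^sub>M j\<in>{1..n}. MX) \<Otimes>\<^sub>M count_space UNIV"

definition treatment_vec :: "nat \<Rightarrow> (nat \<Rightarrow> 'w \<Rightarrow> bool) \<Rightarrow> 'w \<Rightarrow> nat \<Rightarrow> bool" where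
  "treatment_vec n D \<omega> = (\<lambda>j\<in>{1..n}. D j \<omega>)"

definition treatment_space :: "nat \<Rightarrow> (nat \<Rightarrow> bool) measure" where
  "treatment_space n = (\<Pi>\<^sub>M j\<in>{1..n}. count_space UNIV)"

definition nbhd_exposure_mapping ::
  "nat \<Rightarrow> (nat \<Rightarrow> nat \<Rightarrow> bool) \<Rightarrow> real \<Rightarrow> (nat \<Rightarrow> (nat \<Rightarrow> bool) \<Rightarrow> 't) \<Rightarrow> bool" where
  "nbhd_exposure_mapping n A K f \<longleftrightarrow>
     (\<forall>i\<in>{1..n}. \<forall>d\<in>assignments {1..n}. \<forall>d'\<in>assignments {1..n}.
        (\<forall>j\<in>nbhd n A i K. d j = d' j) \<longrightarrow> f i d = f i d')"

text \<open>\<open>E[Z | T = t, C]\<close>, that is, \<open>c \<mapsto> E[Z | T = t, C = c]\<close> evaluated at the random element \<open>C\<close>.\<close>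

definition cond_mean_at ::
  "'w measure \<Rightarrow> 'c measure \<Rightarrow> ('w \<Rightarrow> 'c) \<Rightarrow> ('w \<Rightarrow> 't::topological_space) \<Rightarrow> ('w \<Rightarrow> real) \<Rightarrow>
   't \<Rightarrow> 'w \<Rightarrow> real" where
  "cond_mean_at M N C T Z t \<omega> =
     cond_mean M (borel \<Otimes>\<^sub>M N) (\<lambda>\<omega>'. (T \<omega>', C \<omega>')) Z (t, C \<omega>)"

definition exposure_contrast ::
  "'w measure \<Rightarrow> nat \<Rightarrow> 'c measure \<Rightarrow> (nat \<Rightarrow> 'w \<Rightarrow> 'c) \<Rightarrow> (nat \<Rightarrow> 'w \<Rightarrow> 't::topological_space) \<Rightarrow>
   (nat \<Rightarrow> 'w \<Rightarrow> real) \<Rightarrow> 't \<Rightarrow> 't \<Rightarrow> 'w \<Rightarrow> real" where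
  "exposure_contrast M n N C T Y t t' \<omega> =
     1 / real n * (\<Sum>i=1..n. cond_mean_at M N (C i) (T i) (Y i) t \<omega>
                            - cond_mean_at M N (C i) (T i) (Y i) t' \<omega>)"

text \<open>
  The conditional law of the treatments given \<open>T_i = s\<close> and \<open>C_i = c\<close> exists when the event
  \<open>T_i = s\<close> has positive probability given \<open>C_i = c\<close>. Since the latter is determined only up to null
  sets of the law of \<open>C_i\<close>, ``every \<open>c\<close> in the support'' is read as almost every \<open>c\<close>.
\<close>

definition overlap ::
  "'w measure \<Rightarrow> nat \<Rightarrow> 'c measure \<Rightarrow> (nat \<Rightarrow> 'w \<Rightarrow> 'c) \<Rightarrow> (nat \<Rightarrow> 'w \<Rightarrow> 't) \<Rightarrow> 't set \<Rightarrow> bool" where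
  "overlap M n N C T Ts \<longleftrightarrow>
     (\<forall>i\<in>{1..n}. \<forall>s\<in>Ts. AE c in distr M N (C i).
        0 < cond_mean M N (C i) (\<lambda>\<omega>. indicator {s} (T i \<omega>)) c)"

text \<open>
  The process \<open>d \<mapsto> Ypot d\<close>, indexed by the assignments of \<open>S\<close>, is independent of the treatment
  vector given \<open>C\<close>.
\<close>

definition unconfounded ::
  "'w measure \<Rightarrow> nat \<Rightarrow> (nat \<Rightarrow> 'w \<Rightarrow> bool) \<Rightarrow> 'c measure \<Rightarrow> ('w \<Rightarrow> 'c) \<Rightarrow>
   nat set \<Rightarrow> ((nat \<Rightarrow> bool) \<Rightarrow> 'w \<Rightarrow> real) \<Rightarrow> bool" where
  "unconfounded M n D N C S Ypot \<longleftrightarrow>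
     cond_indep M (\<Pi>\<^sub>M d\<in>assignments S. borel) (\<lambda>\<omega>. \<lambda>d\<in>assignments S. Ypot d \<omega>)
       (treatment_space n) (treatment_vec n D) N C"

end

(*
  Write Z for the outcome of unit i in the K-neighborhood model, R for its value at the baseline
  delta_i, and m_s(V) for E[V | T_i = s, C_i]. Then
    (m_t(Y) - m_t'(Y)) - m_t(Z - R) = (m_t(Y) - m_t(Z)) - (m_t'(Y) - m_t'(Z)) + (m_t(R) - m_t'(Z)).
  The first two brackets are bounded by gamma(K), since (T_i, C_i) is a function of (D, X, A).
  The last one vanishes: degeneracy gives m_t'(Z) = m_t'(R), and by unconfoundedness
  m_t(R) = E[R | C_i] = m_t'(R). Each of these facts is first known only on the event T_i = s;
  overlap extends it to almost every value of C_i.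
*)

theory Submission
  imports Defs
begin

section \<open>Sigma-algebras generated by random elements\<close>

lemma measurable_sigma_gen:
  assumes "W \<in> measurable M N"
  shows "W \<in> measurable (sigma_gen M N W) N"
  unfolding sigma_gen_def
  by (rule measurable_vimage_algebra1) (use measurable_space[OF assms] in auto)

lemma subalgebra_sigma_gen:
  assumes "W \<in> measurable M N"
  shows "subalgebra M (sigma_gen M N W)"
  unfolding subalgebra_def sigma_gen_def
  using sets_image_in_sets[OF _ assms] by simp

text \<open>The composition is already measurable with respect to the sigma-algebra of
  \<open>W\<close>, so it generates a coarser one. This supplies the nesting for the tower
  property.\<close>

lemma subalgebra_sigma_gen_comp:
  assumes "W \<in> measurable M N" "\<phi> \<in> measurable N N'"
  shows "subalgebra (sigma_gen M N W) (sigma_gen M N' (\<lambda>\<omega>. \<phi> (W \<omega>)))"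
proof -
  have "(\<lambda>\<omega>. \<phi> (W \<omega>)) \<in> measurable (sigma_gen M N W) N'"
    using measurable_compose[OF measurable_sigma_gen[OF assms(1)] assms(2)] .
  \<comment> \<open>\<open>sigma_gen\<close> uses only the space of its first argument, so
    generating inside \<open>sigma_gen M N W\<close> or inside \<open>M\<close> gives the same
    sigma-algebra.\<close>
  from subalgebra_sigma_gen[OF this] show ?thesis
    by (simp add: sigma_gen_def)
qed

context prob_space
begin

section \<open>Conditional means given a random element\<close>

lemma sigma_finite_subalgebra_sigma_gen:
  assumes "W \<in> measurable M N"
  shows "sigma_finite_subalgebra M (sigma_gen M N W)"
proof -
  have "finite_measure_subalgebra M (sigma_gen M N W)"
    using subalgebra_sigma_gen[OF assms]
    by (intro finite_measure_subalgebra.intro finite_measure_subalgebra_axioms.intro)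
       (auto intro: finite_measure_axioms)
  then show ?thesis
    by (rule finite_measure_subalgebra_is_sigma_finite)
qed

text \<open>By the tower property the coarser conditional expectation averages the finer one. It
  carries the interference bound from treatments and controls over to exposure and controls.\<close>

lemma AE_cond_exp_comp_le:
  assumes W: "W \<in> measurable M N" and \<phi>: "\<phi> \<in> measurable N N'"
    and Z: "integrable M Z"
    and le: "AE \<omega> in M. real_cond_exp M (sigma_gen M N W) Z \<omega> \<le> c"
  shows "AE \<omega> in M. real_cond_exp M (sigma_gen M N' (\<lambda>\<omega>. \<phi> (W \<omega>))) Z \<omega> \<le> c"
proof -
  let ?G = "sigma_gen M N W" and ?F = "sigma_gen M N' (\<lambda>\<omega>. \<phi> (W \<omega>))"
  interpret G: sigma_finite_subalgebra M ?G
    by (rule sigma_finite_subalgebra_sigma_gen[OF W])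
  interpret F: sigma_finite_subalgebra M ?F
    by (rule sigma_finite_subalgebra_sigma_gen[OF measurable_compose[OF W \<phi>]])
  have "AE \<omega> in M. real_cond_exp M ?F (real_cond_exp M ?G Z) \<omega> \<le> c"
    by (rule F.real_cond_exp_le_c[OF G.real_cond_exp_int(1)[OF Z] le])
  moreover have "AE \<omega> in M. real_cond_exp M ?F (real_cond_exp M ?G Z) \<omega> = real_cond_exp M ?F Z \<omega>"
    by (rule F.real_cond_exp_nested_subalg[OF subalgebra_sigma_gen[OF W]
          subalgebra_sigma_gen_comp[OF W \<phi>] Z])
  ultimately show ?thesis by eventually_elim simp
qed

lemma AE_cond_mean_diff:
  assumes W: "W \<in> measurable M N" and Z: "integrable M Z" and Z': "integrable M Z'"
  shows "AE \<omega> in M. cond_mean M N W (\<lambda>\<omega>. Z \<omega> - Z' \<omega>) (W \<omega>)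
           = cond_mean M N W Z (W \<omega>) - cond_mean M N W Z' (W \<omega>)"
proof -
  interpret sigma_finite_subalgebra M "sigma_gen M N W"
    by (rule sigma_finite_subalgebra_sigma_gen[OF W])
  show ?thesis
    using real_cond_exp_diff[OF Z Z'] cond_mean_AE(2)[OF W, of Z] cond_mean_AE(2)[OF W, of Z']
      cond_mean_AE(2)[OF W, of "\<lambda>\<omega>. Z \<omega> - Z' \<omega>"]
    by eventually_elim simp
qed

text \<open>Monotonicity, applied to both \<open>Z - Z'\<close> and \<open>Z' - Z\<close>, takes the
  place of the conditional Jensen inequality for the absolute value.\<close>

lemma AE_cond_mean_abs_diff_le:
  assumes W: "W \<in> measurable M N" and Z: "integrable M Z" and Z': "integrable M Z'"
    and le: "AE \<omega> in M. real_cond_exp M (sigma_gen M N W) (\<lambda>\<omega>. \<bar>Z \<omega> - Z' \<omega>\<bar>) \<omega> \<le> c"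
  shows "AE \<omega> in M. \<bar>cond_mean M N W Z (W \<omega>) - cond_mean M N W Z' (W \<omega>)\<bar> \<le> c"
proof -
  let ?G = "sigma_gen M N W"
  interpret sigma_finite_subalgebra M ?G
    by (rule sigma_finite_subalgebra_sigma_gen[OF W])
  have "AE \<omega> in M. real_cond_exp M ?G (\<lambda>\<omega>. Z \<omega> - Z' \<omega>) \<omega>
      \<le> real_cond_exp M ?G (\<lambda>\<omega>. \<bar>Z \<omega> - Z' \<omega>\<bar>) \<omega>"
    by (rule real_cond_exp_mono) (use Z Z' in auto)
  moreover have "AE \<omega> in M. real_cond_exp M ?G (\<lambda>\<omega>. Z' \<omega> - Z \<omega>) \<omega>
      \<le> real_cond_exp M ?G (\<lambda>\<omega>. \<bar>Z \<omega> - Z' \<omega>\<bar>) \<omega>"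
    by (rule real_cond_exp_mono) (use Z Z' in auto)
  ultimately show ?thesis
    using le real_cond_exp_diff[OF Z Z'] real_cond_exp_diff[OF Z' Z]
      cond_mean_AE(2)[OF W, of Z] cond_mean_AE(2)[OF W, of Z']
    by eventually_elim linarith
qed

text \<open>The event \<open>W \<omega> \<in> E\<close> lies in the sigma-algebra of
  \<open>W\<close>, so its indicator can be pulled out of the conditional expectation of
  \<open>Z - Z'\<close>. It serves for degeneracy, which gives an equality of outcomes only on the
  event of exposure \<open>t'\<close>.\<close>

lemma AE_cond_mean_eq_on:
  assumes W: "W \<in> measurable M N" and Z: "integrable M Z" and Z': "integrable M Z'"
    and E: "E \<in> sets N" and eq: "AE \<omega> in M. W \<omega> \<in> E \<longrightarrow> Z \<omega> = Z' \<omega>"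
  shows "AE \<omega> in M. W \<omega> \<in> E \<longrightarrow> cond_mean M N W Z (W \<omega>) = cond_mean M N W Z' (W \<omega>)"
proof -
  let ?G = "sigma_gen M N W" and ?e = "\<lambda>\<omega>. indicat_real E (W \<omega>)"
  interpret sigma_finite_subalgebra M ?G
    by (rule sigma_finite_subalgebra_sigma_gen[OF W])
  note [measurable] = W E measurable_sigma_gen[OF W] borel_measurable_integrable[OF Z]
    borel_measurable_integrable[OF Z']
  have "integrable M (\<lambda>\<omega>. ?e \<omega> * (Z \<omega> - Z' \<omega>))"
    by (rule Bochner_Integration.integrable_bound[of M "\<lambda>\<omega>. Z \<omega> - Z' \<omega>"])
       (use Z Z' in \<open>auto simp: indicator_def\<close>)
  then have "AE \<omega> in M. real_cond_exp M ?G (\<lambda>\<omega>. ?e \<omega> * (Z \<omega> - Z' \<omega>)) \<omega>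
      = ?e \<omega> * real_cond_exp M ?G (\<lambda>\<omega>. Z \<omega> - Z' \<omega>) \<omega>"
    by (intro real_cond_exp_mult) measurable
  moreover have "AE \<omega> in M. real_cond_exp M ?G (\<lambda>\<omega>. ?e \<omega> * (Z \<omega> - Z' \<omega>)) \<omega>
      = real_cond_exp M ?G (\<lambda>\<omega>. 0) \<omega>"
    by (rule real_cond_exp_cong) (use eq in \<open>auto elim!: eventually_mono simp: indicator_def\<close>)
  moreover have "AE \<omega> in M. real_cond_exp M ?G (\<lambda>\<omega>. 0) \<omega> = 0"
    by (rule real_cond_exp_F_meas) auto
  ultimately show ?thesis
    using AE_cond_mean_diff[OF W Z Z'] cond_mean_AE(2)[OF W, of "\<lambda>\<omega>. Z \<omega> - Z' \<omega>"]
    by eventually_elim (auto simp: indicator_def)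
qed

section \<open>Overlap and conditional independence\<close>

text \<open>A property of \<open>C\<close> that holds on the event \<open>S\<close> holds almost surely, because every \<open>C\<close>-measurable
  non-null event meets \<open>S\<close> with positive probability.\<close>

lemma AE_from_overlap:
  assumes C: "C \<in> measurable M N" and S: "Measurable.pred M S"
    and pos: "AE c in distr M N C. 0 < cond_mean M N C (\<lambda>\<omega>. of_bool (S \<omega>)) c"
    and Q: "Measurable.pred N Q" and AE: "AE \<omega> in M. S \<omega> \<longrightarrow> Q (C \<omega>)"
  shows "AE \<omega> in M. Q (C \<omega>)"
proof -
  let ?G = "sigma_gen M N C" and ?S = "\<lambda>\<omega>. of_bool (S \<omega>) :: real"
  let ?p = "real_cond_exp M ?G ?S" and ?b = "\<lambda>\<omega>. of_bool (\<not> Q (C \<omega>)) :: real"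
  interpret sigma_finite_subalgebra M ?G
    by (rule sigma_finite_subalgebra_sigma_gen[OF C])
  note [measurable] = C S Q measurable_sigma_gen[OF C] cond_mean_AE(1)[OF C]
  have "AE \<omega> in M. 0 < cond_mean M N C ?S (C \<omega>)"
    using pos by (subst (asm) AE_distr_iff) auto
  with cond_mean_AE(2)[OF C, of ?S] have p: "AE \<omega> in M. 0 < ?p \<omega>"
    by eventually_elim simp
  have S_meas: "?S \<in> borel_measurable M" by measurable
  have b_meas: "?b \<in> borel_measurable ?G" by measurable
  have int: "integrable M (\<lambda>\<omega>. ?b \<omega> * ?S \<omega>)"
    by (rule integrable_const_bound[of _ 1]) auto
  have zero: "AE \<omega> in M. ?b \<omega> * ?S \<omega> = 0"
    using AE by eventually_elim auto
  \<comment> \<open>\<open>?b\<close> flags the failure of \<open>Q\<close>, a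
    \<open>C\<close>-measurable event, so under the integral \<open>?S\<close> may be exchanged with
    its conditional probability \<open>?p\<close>. Once the integral is seen to vanish, positivity
    of \<open>?p\<close> forces \<open>?b\<close> to vanish almost surely.\<close>
  have "(\<integral>\<omega>. ?b \<omega> * ?p \<omega> \<partial>M) = (\<integral>\<omega>. ?b \<omega> * ?S \<omega> \<partial>M)"
    by (rule real_cond_exp_intg(2)[OF int b_meas S_meas])
  also have "\<dots> = 0"
    by (rule integral_eq_zero_AE[OF zero])
  finally have "(\<integral>\<omega>. ?b \<omega> * ?p \<omega> \<partial>M) = 0" .
  moreover have "AE \<omega> in M. 0 \<le> ?b \<omega> * ?p \<omega>" using p by eventually_elim auto
  ultimately have "AE \<omega> in M. ?b \<omega> * ?p \<omega> = 0"
    using integral_nonneg_eq_0_iff_AE[OF real_cond_exp_intg(1)[OF int b_meas S_meas]] by simp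
  with p show ?thesis by eventually_elim auto
qed

text \<open>Both sides integrate \<open>R\<close> against a finite measure on \<open>M\<close>; conditional independence says that
  the images of these two measures under \<open>R\<close> agree on all Borel sets, which avoids approximating
  \<open>R\<close> by simple functions.\<close>

lemma integral_cond_indep:
  fixes R :: "'a \<Rightarrow> real"
  assumes C: "C \<in> measurable M N" and S: "Measurable.pred M S" and R: "R \<in> borel_measurable M"
    and indep: "\<And>B. B \<in> sets borel \<Longrightarrow> AE \<omega> in M.
      real_cond_exp M (sigma_gen M N C) (\<lambda>\<omega>. indicator B (R \<omega>) * of_bool (S \<omega>)) \<omega>
      = real_cond_exp M (sigma_gen M N C) (\<lambda>\<omega>. indicator B (R \<omega>)) \<omega>
        * real_cond_exp M (sigma_gen M N C) (\<lambda>\<omega>. of_bool (S \<omega>)) \<omega>"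
    and E: "E \<in> sets N"
  shows "(\<integral>\<omega>. indicator E (C \<omega>) * of_bool (S \<omega>) * R \<omega> \<partial>M)
    = (\<integral>\<omega>. indicator E (C \<omega>) * real_cond_exp M (sigma_gen M N C) (\<lambda>\<omega>. of_bool (S \<omega>)) \<omega> * R \<omega> \<partial>M)"
proof -
  let ?G = "sigma_gen M N C" and ?S = "\<lambda>\<omega>. of_bool (S \<omega>) :: real"
  let ?p = "real_cond_exp M ?G ?S" and ?e = "\<lambda>\<omega>. indicat_real E (C \<omega>)"
  interpret sigma_finite_subalgebra M ?G
    by (rule sigma_finite_subalgebra_sigma_gen[OF C])
  note [measurable] = C S R E measurable_sigma_gen[OF C]
  have p: "AE \<omega> in M. 0 \<le> ?p \<omega>" by (rule real_cond_exp_pos) auto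
  have "integrable M ?S" by (rule integrable_const_bound[of _ 1]) auto
  then have p_int: "integrable M ?p" by (rule real_cond_exp_int(1))
  have e_meas [measurable]: "?e \<in> borel_measurable ?G" by measurable
  have eS_int: "integrable M (\<lambda>\<omega>. f \<omega> * ?S \<omega>)"
    if "f \<in> borel_measurable M" "\<And>\<omega>. f \<omega> \<in> {0..1}" for f :: "'a \<Rightarrow> real"
    by (rule integrable_const_bound[of _ 1]) (use that in auto)
  have ep_int: "integrable M (\<lambda>\<omega>. f \<omega> * ?p \<omega>)"
    if "f \<in> borel_measurable M" "\<And>\<omega>. f \<omega> \<in> {0..1}" for f :: "'a \<Rightarrow> real"
    by (rule Bochner_Integration.integrable_bound[OF p_int])
       (use that in \<open>auto simp: abs_mult intro!: mult_left_le_one_le\<close>)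
  \<comment> \<open>Conditioning on \<open>C\<close> lets independence split the product; as
    \<open>?e * ?p\<close> is \<open>C\<close>-measurable, \<open>?q\<close> can then be turned back
    into the plain indicator of \<open>B\<close>.\<close>
  have on_sets: "(\<integral>\<omega>. indicator B (R \<omega>) * (?e \<omega> * ?S \<omega>) \<partial>M)
      = (\<integral>\<omega>. indicator B (R \<omega>) * (?e \<omega> * ?p \<omega>) \<partial>M)" if [measurable]: "B \<in> sets borel" for B
  proof -
    let ?B = "\<lambda>\<omega>. indicat_real B (R \<omega>)"
    let ?q = "real_cond_exp M ?G ?B"
    have "(\<integral>\<omega>. ?B \<omega> * (?e \<omega> * ?S \<omega>) \<partial>M) = (\<integral>\<omega>. ?e \<omega> * (?B \<omega> * ?S \<omega>) \<partial>M)"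
      by (simp add: mult_ac)
    also have "\<dots> = (\<integral>\<omega>. ?e \<omega> * real_cond_exp M ?G (\<lambda>\<omega>. ?B \<omega> * ?S \<omega>) \<omega> \<partial>M)"
      by (rule real_cond_exp_intg(2)[symmetric])
         (auto intro!: integrable_const_bound[of _ 1] simp: indicator_def)
    also have "\<dots> = (\<integral>\<omega>. (?e \<omega> * ?p \<omega>) * ?q \<omega> \<partial>M)"
      by (rule integral_cong_AE) (use indep[OF that] in \<open>auto elim!: eventually_mono\<close>)
    also have "\<dots> = (\<integral>\<omega>. (?e \<omega> * ?p \<omega>) * ?B \<omega> \<partial>M)"
    proof (rule real_cond_exp_intg(2))
      have "integrable M (\<lambda>\<omega>. (?B \<omega> * ?e \<omega>) * ?p \<omega>)"
        by (rule ep_int) (auto simp: indicator_def)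
      then show "integrable M (\<lambda>\<omega>. (?e \<omega> * ?p \<omega>) * ?B \<omega>)" by (simp add: mult_ac)
    qed auto
    finally show ?thesis by (simp add: mult_ac)
  qed
  define M1 where "M1 = density M (\<lambda>\<omega>. ennreal (?e \<omega> * ?S \<omega>))"
  define M2 where "M2 = density M (\<lambda>\<omega>. ennreal (?e \<omega> * ?p \<omega>))"
  have p': "AE \<omega> in M. 0 \<le> ?e \<omega> * ?p \<omega>" using p by eventually_elim auto
  \<comment> \<open>For an integrable nonnegative density the image measure of \<open>B\<close> is a
    finite real integral, the form in which \<open>on_sets\<close> compares the two
    measures.\<close>
  have emeasure_density_R: "emeasure (distr (density M (\<lambda>\<omega>. ennreal (u \<omega>))) borel R) B
      = ennreal (\<integral>\<omega>. indicator B (R \<omega>) * u \<omega> \<partial>M)"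
    if u: "integrable M u" "AE \<omega> in M. 0 \<le> u \<omega>" and B [measurable]: "B \<in> sets borel"
    for u :: "'a \<Rightarrow> real" and B
  proof -
    have [measurable]: "u \<in> borel_measurable M" using u by auto
    have "emeasure (distr (density M (\<lambda>\<omega>. ennreal (u \<omega>))) borel R) B
        = (\<integral>\<^sup>+\<omega>. ennreal (u \<omega>) * indicator (R -` B \<inter> space M) \<omega> \<partial>M)"
      by (subst emeasure_distr) (auto simp: emeasure_density)
    also have "\<dots> = (\<integral>\<^sup>+\<omega>. ennreal (indicator B (R \<omega>) * u \<omega>) \<partial>M)"
      by (rule nn_integral_cong) (auto simp: indicator_def)
    also have "\<dots> = ennreal (\<integral>\<omega>. indicator B (R \<omega>) * u \<omega> \<partial>M)"
    proof (rule nn_integral_eq_integral)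
      show "integrable M (\<lambda>\<omega>. indicator B (R \<omega>) * u \<omega>)"
        by (rule Bochner_Integration.integrable_bound[OF u(1)]) (auto simp: indicator_def)
      show "AE \<omega> in M. 0 \<le> indicator B (R \<omega>) * u \<omega>"
        using u(2) by eventually_elim (auto simp: indicator_def)
    qed
    finally show ?thesis .
  qed
  have eq: "distr M1 borel R = distr M2 borel R"
  proof (rule measure_eqI)
    fix B assume "B \<in> sets (distr M1 borel R)"
    then have B: "B \<in> sets borel" by simp
    show "emeasure (distr M1 borel R) B = emeasure (distr M2 borel R) B"
      unfolding M1_def M2_def
      by (subst (1 2) emeasure_density_R)
         (use on_sets[OF B] B p' in \<open>auto intro!: eS_int ep_int\<close>)
  qed simp
  \<comment> \<open>\<open>R\<close> is only measurable here: the changes of density and of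
    variables are equalities of Bochner integrals, with the default value 0 on both sides when the
    integrand is not integrable.\<close>
  have "(\<integral>\<omega>. ?e \<omega> * ?S \<omega> * R \<omega> \<partial>M) = (\<integral>\<omega>. R \<omega> \<partial>M1)"
    unfolding M1_def by (subst integral_density) auto
  also have "\<dots> = (\<integral>x. x \<partial>distr M1 borel R)"
    by (rule integral_distr[symmetric]) (auto simp: M1_def)
  also have "\<dots> = (\<integral>\<omega>. R \<omega> \<partial>M2)"
    unfolding eq by (rule integral_distr) (auto simp: M2_def)
  also have "\<dots> = (\<integral>\<omega>. ?e \<omega> * ?p \<omega> * R \<omega> \<partial>M)"
    unfolding M2_def by (subst integral_density) (use p' in auto)
  finally show ?thesis .
qed

text \<open>On the slice \<open>T \<omega> = s\<close> every event of the sigma-algebra of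
  \<open>(T, C)\<close> reduces to an event of \<open>C\<close>, so comparing integrals over
  \<open>C\<close>-events suffices. There, conditional independence lets the indicator of the slice
  be exchanged with its probability given \<open>C\<close>.\<close>

lemma AE_cond_mean_exposure_irrelevant:
  fixes R :: "'a \<Rightarrow> real" and T :: "'a \<Rightarrow> 't::t1_space"
  assumes C: "C \<in> measurable M N" and T: "T \<in> borel_measurable M" and R: "integrable M R"
    and indep: "\<And>B. B \<in> sets borel \<Longrightarrow> AE \<omega> in M.
      real_cond_exp M (sigma_gen M N C) (\<lambda>\<omega>. indicator B (R \<omega>) * of_bool (T \<omega> = s)) \<omega>
      = real_cond_exp M (sigma_gen M N C) (\<lambda>\<omega>. indicator B (R \<omega>)) \<omega>
        * real_cond_exp M (sigma_gen M N C) (\<lambda>\<omega>. of_bool (T \<omega> = s)) \<omega>"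
  shows "AE \<omega> in M. T \<omega> = s \<longrightarrow>
    cond_mean M (borel \<Otimes>\<^sub>M N) (\<lambda>\<omega>. (T \<omega>, C \<omega>)) R (s, C \<omega>) = cond_mean M N C R (C \<omega>)"
proof -
  let ?W = "\<lambda>\<omega>. (T \<omega>, C \<omega>)"
  let ?F = "sigma_gen M N C" and ?G = "sigma_gen M (borel \<Otimes>\<^sub>M N) ?W"
  let ?S = "\<lambda>\<omega>. of_bool (T \<omega> = s) :: real"
  let ?p = "real_cond_exp M ?F ?S" and ?r = "real_cond_exp M ?F R"
  have W: "?W \<in> measurable M (borel \<Otimes>\<^sub>M N)" using C T by measurable
  interpret F: sigma_finite_subalgebra M ?F
    by (rule sigma_finite_subalgebra_sigma_gen[OF C])
  interpret G: sigma_finite_subalgebra M ?G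
    by (rule sigma_finite_subalgebra_sigma_gen[OF W])
  have W_G: "?W \<in> measurable ?G (borel \<Otimes>\<^sub>M N)" by (rule measurable_sigma_gen[OF W])
  have T_G: "T \<in> borel_measurable ?G" using measurable_compose[OF W_G measurable_fst] by simp
  have [measurable]: "{s} \<in> sets borel" by (rule borel_closed) simp
  have TS [measurable]: "Measurable.pred N' (\<lambda>\<omega>. T \<omega> = s)" if [measurable]: "T \<in> borel_measurable N'" for N'
  proof -
    have "Measurable.pred N' (\<lambda>\<omega>. T \<omega> \<in> {s})" by measurable
    then show ?thesis by simp
  qed
  note [measurable] = C T R T_G measurable_sigma_gen[OF C] borel_measurable_integrable[OF R]
  have S_G: "?S \<in> borel_measurable ?G" by measurable
  have "subalgebra ?G ?F" using subalgebra_sigma_gen_comp[OF W measurable_snd] by simp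
  then have r_G [measurable]: "?r \<in> borel_measurable ?G"
    by (rule measurable_from_subalg) (rule borel_measurable_cond_exp)
  have r_int: "integrable M ?r" using R by (rule F.real_cond_exp_int(1))
  have int_mult: "integrable M (\<lambda>\<omega>. f \<omega> * v \<omega>)"
    if [measurable]: "f \<in> borel_measurable M" and "\<And>\<omega>. f \<omega> \<in> {0..1}" and v: "integrable M v"
    for f v :: "'a \<Rightarrow> real"
    by (rule Bochner_Integration.integrable_bound[OF v])
       (use that in \<open>auto simp: abs_mult intro!: mult_left_le_one_le\<close>)
  have p_bounds: "AE \<omega> in M. 0 \<le> ?p \<omega> \<and> ?p \<omega> \<le> 1"
  proof -
    have "integrable M ?S" by (rule integrable_const_bound[of _ 1]) auto
    then have "AE \<omega> in M. ?p \<omega> \<le> 1" by (rule F.real_cond_exp_le_c) auto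
    moreover have "AE \<omega> in M. 0 \<le> ?p \<omega>" by (rule F.real_cond_exp_pos) auto
    ultimately show ?thesis by eventually_elim simp
  qed
  have p_int: "integrable M (\<lambda>\<omega>. indicator E (C \<omega>) * ?p \<omega> * v \<omega>)"
    if v: "integrable M v" and [measurable]: "E \<in> sets N" for v E
  proof (rule Bochner_Integration.integrable_bound[OF v])
    show "(\<lambda>\<omega>. indicator E (C \<omega>) * ?p \<omega> * v \<omega>) \<in> borel_measurable M" using v by measurable
    show "AE \<omega> in M. norm (indicator E (C \<omega>) * ?p \<omega> * v \<omega>) \<le> norm (v \<omega>)"
      using p_bounds
      by eventually_elim (auto simp: indicator_def abs_mult intro!: mult_left_le_one_le)
  qed
  \<comment> \<open>Three exchanges: \<open>?S\<close> for \<open>?p\<close> by independence,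
    \<open>R\<close> for \<open>?r\<close> because \<open>?e * ?p\<close> is
    \<open>C\<close>-measurable, and \<open>?p\<close> back for \<open>?S\<close> because
    \<open>?e * ?r\<close> is \<open>C\<close>-measurable.\<close>
  have key: "(\<integral>\<omega>. indicator E (C \<omega>) * (?S \<omega> * R \<omega>) \<partial>M) = (\<integral>\<omega>. indicator E (C \<omega>) * (?S \<omega> * ?r \<omega>) \<partial>M)"
    if E [measurable]: "E \<in> sets N" for E
  proof -
    let ?e = "\<lambda>\<omega>. indicat_real E (C \<omega>)"
    have "(\<integral>\<omega>. ?e \<omega> * (?S \<omega> * R \<omega>) \<partial>M) = (\<integral>\<omega>. ?e \<omega> * ?p \<omega> * R \<omega> \<partial>M)"
      using integral_cond_indep[OF C _ _ indep E] by (simp add: mult.assoc)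
    also have "\<dots> = (\<integral>\<omega>. ?e \<omega> * ?p \<omega> * ?r \<omega> \<partial>M)"
      by (rule F.real_cond_exp_intg(2)[symmetric]) (auto intro: p_int R)
    also have "\<dots> = (\<integral>\<omega>. (?e \<omega> * ?r \<omega>) * ?p \<omega> \<partial>M)" by (simp add: mult_ac)
    also have "\<dots> = (\<integral>\<omega>. (?e \<omega> * ?r \<omega>) * ?S \<omega> \<partial>M)"
    proof (rule F.real_cond_exp_intg(2))
      have "integrable M (\<lambda>\<omega>. (?e \<omega> * ?S \<omega>) * ?r \<omega>)"
        by (rule int_mult) (auto simp: r_int indicator_def)
      then show "integrable M (\<lambda>\<omega>. (?e \<omega> * ?r \<omega>) * ?S \<omega>)" by (simp add: mult_ac)
    qed auto
    finally show ?thesis by (simp add: mult_ac)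
  qed
  have "AE \<omega> in M. real_cond_exp M ?G (\<lambda>\<omega>. ?S \<omega> * R \<omega>) \<omega> = ?S \<omega> * ?r \<omega>"
  proof (rule G.real_cond_exp_charact)
    fix A assume "A \<in> sets ?G"
    then obtain E where E: "E \<in> sets (borel \<Otimes>\<^sub>M N)" "A = ?W -` E \<inter> space M"
      unfolding sigma_gen_def
      by (subst (asm) sets_vimage_algebra2) (use measurable_space[OF W] in auto)
    \<comment> \<open>The section of \<open>E\<close> at exposure \<open>s\<close> is all that the
      factor \<open>?S\<close> leaves visible of \<open>E\<close>.\<close>
    let ?E = "Pair s -` E"
    have slice: "?E \<in> sets N" using sets_Pair1[OF E(1)] .
    have "indicator A \<omega> * ?S \<omega> = indicator ?E (C \<omega>) * ?S \<omega>" if "\<omega> \<in> space M" for \<omega>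
      using that by (auto simp: E(2) indicator_def)
    then have "(\<integral>\<omega>\<in>A. ?S \<omega> * u \<omega> \<partial>M) = (\<integral>\<omega>. indicator ?E (C \<omega>) * (?S \<omega> * u \<omega>) \<partial>M)" for u
      unfolding set_lebesgue_integral_def
      by (intro Bochner_Integration.integral_cong refl) (simp add: mult.assoc[symmetric])
    with key[OF slice]
    show "(\<integral>\<omega>\<in>A. ?S \<omega> * R \<omega> \<partial>M) = (\<integral>\<omega>\<in>A. ?S \<omega> * ?r \<omega> \<partial>M)" by simp
  qed (auto intro!: int_mult R r_int simp: S_G)
  \<comment> \<open>\<open>?S\<close> is measurable for the joint sigma-algebra and comes out. On
    the slice it equals 1, so the two expressions identify the conditional expectation of
    \<open>R\<close> with \<open>?r\<close> there.\<close>
  moreover have "AE \<omega> in M. real_cond_exp M ?G (\<lambda>\<omega>. ?S \<omega> * R \<omega>) \<omega> = ?S \<omega> * real_cond_exp M ?G R \<omega>"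
    by (rule G.real_cond_exp_mult[OF S_G]) (auto intro!: int_mult R)
  ultimately show ?thesis
    using cond_mean_AE(2)[OF C, of R] cond_mean_AE(2)[OF W, of R]
    by eventually_elim auto
qed

end

section \<open>Treatment vectors, controls and unconfoundedness\<close>

text \<open>Singletons are finite boxes and there are finitely many assignments, so the product
  sigma-algebra is discrete. Hence any exposure mapping is measurable and any predicate on
  assignments defines an event.\<close>

lemma sets_treatment_space: "sets (treatment_space n) = Pow (assignments {1..n})"
proof -
  have fin: "finite (assignments {1..n})" by (intro finite_PiE) auto
  have single: "{d} \<in> sets (treatment_space n)" if "d \<in> assignments {1..n}" for d
  proof -
    have "{d} = (\<Pi>\<^sub>E j\<in>{1..n}. {d j})" using that by (auto simp: PiE_singleton)
    also have "\<dots> \<in> sets (treatment_space n)"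
      unfolding treatment_space_def by (intro sets_PiM_I_finite) auto
    finally show ?thesis .
  qed
  have "S \<in> sets (treatment_space n)" if "S \<subseteq> assignments {1..n}" for S
  proof -
    have "(\<Union>d\<in>S. {d}) \<in> sets (treatment_space n)"
      using single that finite_subset[OF that fin] by (intro sets.finite_UN) blast+
    then show ?thesis by simp
  qed
  moreover have "sets (treatment_space n) \<subseteq> Pow (assignments {1..n})"
    using sets.sets_into_space[of _ "treatment_space n"]
    by (auto simp: treatment_space_def space_PiM)
  ultimately show ?thesis by auto
qed

lemma space_treatment_space: "space (treatment_space n) = assignments {1..n}"
  by (simp add: treatment_space_def space_PiM)

lemma treatment_vec_in_assignments: "treatment_vec n D \<omega> \<in> assignments {1..n}"
  by (auto simp: treatment_vec_def)

lemma measurable_treatment_space: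
  assumes "\<And>d. d \<in> assignments {1..n} \<Longrightarrow> \<phi> d \<in> space N"
  shows "\<phi> \<in> measurable (treatment_space n) N"
  using assms by (auto simp: measurable_def sets_treatment_space space_treatment_space)

lemma measurable_treatment_vec:
  assumes "\<And>i. i \<in> {1..n} \<Longrightarrow> D i \<in> measurable M (count_space UNIV)"
  shows "treatment_vec n D \<in> measurable M (treatment_space n)"
  unfolding treatment_vec_def treatment_space_def
  by (rule measurable_restrict) (rule assms)

lemma measurable_controls:
  assumes "\<And>i. i \<in> {1..n} \<Longrightarrow> X i \<in> measurable M MX"
  shows "controls n X A \<in> measurable M (controls_space n MX)"
  unfolding controls_def controls_space_def
  by (intro measurable_Pair measurable_restrict assms) auto

text \<open>Independence of the whole process is tested on the cylinder over \<open>B\<close> at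
  index \<open>d\<close>, and on the set of assignments satisfying \<open>P\<close>. This gives the
  factorization needed for one potential outcome and one exposure event.\<close>

lemma unconfounded_single:
  assumes unc: "unconfounded M n D N C S Ypot" and d: "d \<in> assignments S"
    and B: "B \<in> sets borel"
  shows "AE \<omega> in M.
      real_cond_exp M (sigma_gen M N C)
        (\<lambda>\<omega>. indicator B (Ypot d \<omega>) * of_bool (P (treatment_vec n D \<omega>))) \<omega>
      = real_cond_exp M (sigma_gen M N C) (\<lambda>\<omega>. indicator B (Ypot d \<omega>)) \<omega>
        * real_cond_exp M (sigma_gen M N C) (\<lambda>\<omega>. of_bool (P (treatment_vec n D \<omega>))) \<omega>"
proof -
  let ?PM = "\<Pi>\<^sub>M d\<in>assignments S. borel :: real measure"
  let ?U = "\<lambda>\<omega>. \<lambda>d\<in>assignments S. Ypot d \<omega>"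
  let ?B = "(\<lambda>y. y d) -` B \<inter> space ?PM" and ?B' = "{d \<in> assignments {1..n}. P d}"
  have B_sets: "?B \<in> sets ?PM"
    by (rule measurable_sets[OF measurable_component_singleton[OF d] B])
  have B'_sets: "?B' \<in> sets (treatment_space n)"
    by (auto simp: sets_treatment_space)
  have U: "indicat_real ?B (?U \<omega>) = indicator B (Ypot d \<omega>)" for \<omega>
    using d by (auto simp: indicator_def space_PiM)
  have V: "indicat_real ?B' (treatment_vec n D \<omega>) = of_bool (P (treatment_vec n D \<omega>))" for \<omega>
    using treatment_vec_in_assignments[of n D \<omega>] by (simp add: indicator_def)
  show ?thesis
    using unc[unfolded unconfounded_def cond_indep_def, rule_format, OF B_sets B'_sets]
    unfolding U V .
qed

section \<open>Approximation of the exposure contrast by the K-neighborhood estimand\<close>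

theorem theorem5:
  fixes M :: "'w measure"
    and n :: nat
    and A :: "nat \<Rightarrow> nat \<Rightarrow> bool"
    and MX :: "'x measure"
    and X :: "nat \<Rightarrow> 'w \<Rightarrow> 'x"
    and eps :: "nat \<Rightarrow> 'w \<Rightarrow> 'e"
    and nu :: "nat \<Rightarrow> 'w \<Rightarrow> 'v"
    and g :: "nat \<Rightarrow> nat \<Rightarrow> (nat \<Rightarrow> bool) \<Rightarrow> (nat \<Rightarrow> 'x) \<Rightarrow> (nat \<Rightarrow> nat \<Rightarrow> bool) \<Rightarrow> (nat \<Rightarrow> 'e) \<Rightarrow> real"
    and h :: "nat \<Rightarrow> nat \<Rightarrow> (nat \<Rightarrow> 'x) \<Rightarrow> (nat \<Rightarrow> nat \<Rightarrow> bool) \<Rightarrow> (nat \<Rightarrow> 'v) \<Rightarrow> bool"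
    and D :: "nat \<Rightarrow> 'w \<Rightarrow> bool"
    and Y :: "nat \<Rightarrow> 'w \<Rightarrow> real"
    and Ypot :: "nat set \<Rightarrow> nat \<Rightarrow> (nat \<Rightarrow> bool) \<Rightarrow> 'w \<Rightarrow> real"
    and f :: "nat \<Rightarrow> (nat \<Rightarrow> bool) \<Rightarrow> real ^ 'dt"
    and T :: "nat \<Rightarrow> 'w \<Rightarrow> real ^ 'dt"
    and C :: "nat \<Rightarrow> 'w \<Rightarrow> (nat \<Rightarrow> 'x) \<times> (nat \<Rightarrow> nat \<Rightarrow> bool)"
    and MC :: "((nat \<Rightarrow> 'x) \<times> (nat \<Rightarrow> nat \<Rightarrow> bool)) measure"
    and t t' :: "real ^ 'dt"
    and K :: real
    and \<gamma> :: "real \<Rightarrow> real"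
    and \<delta> :: "nat \<Rightarrow> nat \<Rightarrow> bool"
    and tau_star :: "'w \<Rightarrow> real"
  assumes prob: "prob_space M"
    and n: "1 \<le> n"
    and K: "0 \<le> K"
    \<comment> \<open>model\<close>
    and Ypot: "Ypot = pot_outcome g X A eps"
    and Y: "\<And>i \<omega>. i \<in> {1..n} \<Longrightarrow> Y i \<omega> = Ypot {1..n} i (treatment_vec n D \<omega>) \<omega>"
    and D: "\<And>i \<omega>. i \<in> {1..n} \<Longrightarrow> \<omega> \<in> space M \<Longrightarrow>
        D i \<omega> = h n i (\<lambda>j\<in>{1..n}. X j \<omega>) (subnet {1..n} A) (\<lambda>j\<in>{1..n}. nu j \<omega>)"
    and C: "\<And>i. i \<in> {1..n} \<Longrightarrow> C i = controls n X A"
    and MC: "MC = controls_space n MX"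
    and T: "\<And>i \<omega>. i \<in> {1..n} \<Longrightarrow> T i \<omega> = f i (treatment_vec n D \<omega>)"
    and f: "nbhd_exposure_mapping n A K f"
    \<comment> \<open>measurability and integrability\<close>
    and X_meas: "\<And>i. i \<in> {1..n} \<Longrightarrow> X i \<in> measurable M MX"
    and D_meas: "\<And>i. i \<in> {1..n} \<Longrightarrow> D i \<in> measurable M (count_space UNIV)"
    and Y_meas: "\<And>i d. i \<in> {1..n} \<Longrightarrow> d \<in> assignments {1..n} \<Longrightarrow>
        Ypot {1..n} i d \<in> borel_measurable M"
    and Ys_meas: "\<And>i s d. i \<in> {1..n} \<Longrightarrow> 0 \<le> s \<Longrightarrow> d \<in> assignments (nbhd n A i s) \<Longrightarrow>
        Ypot (nbhd n A i s) i d \<in> borel_measurable M"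
    and Y_int: "\<And>i. i \<in> {1..n} \<Longrightarrow> integrable M (Y i)"
    and Ys_int: "\<And>i s. i \<in> {1..n} \<Longrightarrow> 0 \<le> s \<Longrightarrow>
        integrable M (\<lambda>\<omega>. Ypot (nbhd n A i s) i (restrict (treatment_vec n D \<omega>) (nbhd n A i s)) \<omega>)"
    and Y\<delta>_int: "\<And>i. i \<in> {1..n} \<Longrightarrow> integrable M (Ypot (nbhd n A i K) i (\<delta> i))"
    \<comment> \<open>overlap\<close>
    and overlap: "overlap M n MC C T {t, t'}"
    \<comment> \<open>unconfoundedness, for the full and for the K-neighborhood potential outcomes\<close>
    and unconf: "\<And>i. i \<in> {1..n} \<Longrightarrow>
        unconfounded M n D MC (C i) {1..n} (Ypot {1..n} i)"
    and unconf_K: "\<And>i. i \<in> {1..n} \<Longrightarrow>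
        unconfounded M n D MC (C i) (nbhd n A i K) (Ypot (nbhd n A i K) i)"
    \<comment> \<open>approximate neighborhood interference\<close>
    and \<gamma>_nonneg: "\<And>s. 0 \<le> s \<Longrightarrow> 0 \<le> \<gamma> s"
    and \<gamma>_lim: "(\<gamma> \<longlongrightarrow> 0) at_top"
    and ani: "\<And>s. 0 \<le> s \<Longrightarrow> AE \<omega> in M.
        (MAX i\<in>{1..n}. real_cond_exp M
           (sigma_gen M (treatment_space n \<Otimes>\<^sub>M MC) (\<lambda>\<omega>'. (treatment_vec n D \<omega>', controls n X A \<omega>')))
           (\<lambda>\<omega>'. \<bar>Y i \<omega>' - Ypot (nbhd n A i s) i (restrict (treatment_vec n D \<omega>') (nbhd n A i s)) \<omega>'\<bar>) \<omega>)
        \<le> \<gamma> s"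
    \<comment> \<open>degeneracy at t' under the K-neighborhood model\<close>
    and \<delta>: "\<And>i. i \<in> {1..n} \<Longrightarrow> \<delta> i \<in> assignments (nbhd n A i K)"
    and degenerate: "\<And>i d. i \<in> {1..n} \<Longrightarrow> d \<in> assignments {1..n} \<Longrightarrow> f i d = t' \<Longrightarrow>
        AE \<omega> in M. Ypot (nbhd n A i K) i (restrict d (nbhd n A i K)) \<omega>
                  = Ypot (nbhd n A i K) i (\<delta> i) \<omega>"
    \<comment> \<open>estimand of the K-neighborhood model\<close>
    and tau_star: "\<And>\<omega>. tau_star \<omega> = 1 / real n * (\<Sum>i=1..n.
        cond_mean_at M MC (C i) (T i)
          (\<lambda>\<omega>'. Ypot (nbhd n A i K) i (restrict (treatment_vec n D \<omega>') (nbhd n A i K)) \<omega>'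
                - Ypot (nbhd n A i K) i (\<delta> i) \<omega>') t \<omega>)"
  shows "(AE \<omega> in M. \<bar>exposure_contrast M n MC C T Y t t' \<omega> - tau_star \<omega>\<bar> \<le> 2 * \<gamma> K)
         \<and> ((\<lambda>k. 2 * \<gamma> k) \<longlongrightarrow> 0) at_top"
proof
  interpret prob_space M by (rule prob)
  let ?tv = "treatment_vec n D"
  let ?cm = "\<lambda>i Z s \<omega>. cond_mean_at M MC (C i) (T i) Z s \<omega>"
  define N where "N i = nbhd n A i K" for i
  define Z where "Z i \<omega> = Ypot (N i) i (restrict (?tv \<omega>) (N i)) \<omega>" for i \<omega>
  define R where "R i = Ypot (N i) i (\<delta> i)" for i
  \<comment> \<open>Units are handled one at a time; the factor 2 collects one
    \<open>\<gamma> K\<close> from exposure \<open>t\<close> and one from \<open>t'\<close>.\<close>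
  have unit_bound: "AE \<omega> in M.
      \<bar>?cm i (Y i) t \<omega> - ?cm i (Y i) t' \<omega> - ?cm i (\<lambda>\<omega>. Z i \<omega> - R i \<omega>) t \<omega>\<bar> \<le> 2 * \<gamma> K"
    if i: "i \<in> {1..n}" for i
  proof -
    let ?V = "\<lambda>\<omega>. (?tv \<omega>, controls n X A \<omega>)" and ?W = "\<lambda>\<omega>. (T i \<omega>, C i \<omega>)"
    let ?m = "cond_mean M (borel \<Otimes>\<^sub>M MC) ?W"
    have T_i: "T i = (\<lambda>\<omega>. f i (?tv \<omega>))" using T[OF i] by auto
    have tv: "?tv \<in> measurable M (treatment_space n)"
      using D_meas by (rule measurable_treatment_vec)
    have C_meas: "C i \<in> measurable M MC"
      unfolding C[OF i] MC using X_meas by (rule measurable_controls)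
    have V: "?V \<in> measurable M (treatment_space n \<Otimes>\<^sub>M MC)"
      using tv C_meas unfolding C[OF i] by (rule measurable_Pair)
    have f_meas: "f i \<in> borel_measurable (treatment_space n)"
      by (rule measurable_treatment_space) simp
    have T_meas: "T i \<in> borel_measurable M"
      unfolding T_i using tv f_meas by (rule measurable_compose)
    have W: "?W \<in> measurable M (borel \<Otimes>\<^sub>M MC)"
      using T_meas C_meas by (rule measurable_Pair)
    have Y_i: "integrable M (Y i)" by (rule Y_int[OF i])
    have Z_i: "integrable M (Z i)" unfolding Z_def N_def by (rule Ys_int[OF i K])
    have R_i: "integrable M (R i)" unfolding R_def N_def by (rule Y\<delta>_int[OF i])
    note [measurable] = cond_mean_AE(1)[OF W] cond_mean_AE(1)[OF C_meas] T_meas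

    \<comment> \<open>The estimands evaluate \<open>?m\<close> at \<open>(s, C i \<omega>)\<close>
      even where \<open>T i \<omega>\<close> differs from \<open>s\<close>, while facts about
      \<open>?m\<close> at \<open>?W \<omega>\<close> speak only of outcomes with
      \<open>T i \<omega> = s\<close>. Overlap closes this gap.\<close>
    have slice: "AE \<omega> in M. Q (C i \<omega>)"
      if s: "s \<in> {t, t'}" and Q: "Measurable.pred MC Q"
        and AE: "AE \<omega> in M. T i \<omega> = s \<longrightarrow> Q (C i \<omega>)" for s Q
    proof (rule AE_from_overlap[OF C_meas _ _ Q AE])
      show "Measurable.pred M (\<lambda>\<omega>. T i \<omega> = s)" by measurable
      have "(\<lambda>\<omega>. indicat_real {s} (T i \<omega>)) = (\<lambda>\<omega>. of_bool (T i \<omega> = s))"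
        by (auto simp: indicator_def)
      then show "AE c in distr M MC (C i). 0 < cond_mean M MC (C i) (\<lambda>\<omega>. of_bool (T i \<omega> = s)) c"
        using overlap i s unfolding overlap_def by metis
    qed

    have ani_i: "AE \<omega> in M. \<bar>?m (Y i) (?W \<omega>) - ?m (Z i) (?W \<omega>)\<bar> \<le> \<gamma> K"
    proof (rule AE_cond_mean_abs_diff_le[OF W Y_i Z_i])
      \<comment> \<open>This map sends treatments and controls to exposure and controls, which makes
        \<open>?W\<close> a function of \<open>?V\<close>.\<close>
      let ?\<phi> = "\<lambda>(d, c). (f i d, c)"
      have \<phi>: "?\<phi> \<in> measurable (treatment_space n \<Otimes>\<^sub>M MC) (borel \<Otimes>\<^sub>M MC)"
        using f_meas by measurable
      have "AE \<omega> in M. real_cond_exp M (sigma_gen M (treatment_space n \<Otimes>\<^sub>M MC) ?V)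
          (\<lambda>\<omega>. \<bar>Y i \<omega> - Z i \<omega>\<bar>) \<omega> \<le> \<gamma> K"
        using ani[OF K] unfolding Z_def N_def
      proof eventually_elim
        case (elim \<omega>)
        then show ?case
          by (rule order_trans[rotated]) (use i in \<open>auto intro!: Max_ge\<close>)
      qed
      from AE_cond_exp_comp_le[OF V \<phi> _ this]
      show "AE \<omega> in M. real_cond_exp M (sigma_gen M (borel \<Otimes>\<^sub>M MC) ?W)
          (\<lambda>\<omega>. \<bar>Y i \<omega> - Z i \<omega>\<bar>) \<omega> \<le> \<gamma> K"
        using Y_i Z_i by (simp add: T_i C[OF i])
    qed
    have YZ: "AE \<omega> in M. \<bar>?m (Y i) (s, C i \<omega>) - ?m (Z i) (s, C i \<omega>)\<bar> \<le> \<gamma> K"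
      if "s \<in> {t, t'}" for s
      by (rule slice[OF that]) (measurable, use ani_i in \<open>auto elim!: eventually_mono\<close>)

    have ZR_on: "AE \<omega> in M. ?W \<omega> \<in> {t'} \<times> space MC \<longrightarrow> Z i \<omega> = R i \<omega>"
    proof -
      \<comment> \<open>Degeneracy holds for each fixed assignment outside a null set that may
        depend on it. Finitely many assignments share one null set, so the random treatment vector
        may be inserted.\<close>
      have "finite (assignments {1..n})" by (intro finite_PiE) auto
      then have "AE \<omega> in M. \<forall>d\<in>assignments {1..n}. f i d = t' \<longrightarrow>
          Ypot (N i) i (restrict d (N i)) \<omega> = R i \<omega>"
        using degenerate[OF i] by (subst AE_ball_countable) (auto simp: N_def R_def countable_finite)
      then show ?thesis
        proof eventually_elim
        case (elim \<omega>)
        then show ?case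
          using treatment_vec_in_assignments[of n D \<omega>] by (simp add: Z_def T_i)
      qed
    qed
    have "{t'} \<times> space MC \<in> sets (borel \<Otimes>\<^sub>M MC)" by measurable
    \<comment> \<open>Since \<open>C i \<omega>\<close> always lies in \<open>space MC\<close>,
      membership of \<open>?W \<omega>\<close> in the rectangle amounts to
      \<open>T i \<omega> = t'\<close>.\<close>
    from AE_cond_mean_eq_on[OF W Z_i R_i this ZR_on]
    have "AE \<omega> in M. T i \<omega> = t' \<longrightarrow> ?m (Z i) (t', C i \<omega>) = ?m (R i) (t', C i \<omega>)"
      using AE_space by eventually_elim (use measurable_space[OF C_meas] in auto)
    then have ZR: "AE \<omega> in M. ?m (Z i) (t', C i \<omega>) = ?m (R i) (t', C i \<omega>)"
      by (intro slice[of t']) (simp, measurable)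

    \<comment> \<open>At the nonrandom baseline \<open>\<delta> i\<close> the K-neighborhood process
      is read at a single index, where unconfoundedness applies. The right side does not involve
      \<open>s\<close>, so the baseline has the same mean under both exposures.\<close>
    have R_C: "AE \<omega> in M. ?m (R i) (s, C i \<omega>) = cond_mean M MC (C i) (R i) (C i \<omega>)"
      if s: "s \<in> {t, t'}" for s
    proof (rule slice[OF s])
      show "AE \<omega> in M. T i \<omega> = s \<longrightarrow>
          ?m (R i) (s, C i \<omega>) = cond_mean M MC (C i) (R i) (C i \<omega>)"
      proof (rule AE_cond_mean_exposure_irrelevant[OF C_meas T_meas R_i])
        fix B :: "real set" assume "B \<in> sets borel"
        from unconfounded_single[OF unconf_K[OF i] \<delta>[OF i] this, of "\<lambda>d. f i d = s"]
        show "AE \<omega> in M. real_cond_exp M (sigma_gen M MC (C i))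
            (\<lambda>\<omega>. indicator B (R i \<omega>) * of_bool (T i \<omega> = s)) \<omega>
          = real_cond_exp M (sigma_gen M MC (C i)) (\<lambda>\<omega>. indicator B (R i \<omega>)) \<omega>
            * real_cond_exp M (sigma_gen M MC (C i)) (\<lambda>\<omega>. of_bool (T i \<omega> = s)) \<omega>"
          unfolding R_def N_def T_i .
      qed
    qed measurable

    have ZR_diff: "AE \<omega> in M. ?m (\<lambda>\<omega>. Z i \<omega> - R i \<omega>) (t, C i \<omega>)
        = ?m (Z i) (t, C i \<omega>) - ?m (R i) (t, C i \<omega>)"
      by (rule slice)
         (simp, measurable, use AE_cond_mean_diff[OF W Z_i R_i] in \<open>auto elim!: eventually_mono\<close>)
    \<comment> \<open>\<open>ZR\<close> and the two instances of \<open>R_C\<close> equate the mean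
      of \<open>Z i\<close> at \<open>t'\<close> with that of \<open>R i\<close> at
      \<open>t\<close>. What remains is the difference of the two gaps between \<open>Y i\<close>
      and \<open>Z i\<close>, one per exposure.\<close>
    show ?thesis
      using YZ[of t, simplified] YZ[of t', simplified] ZR R_C[of t, simplified]
        R_C[of t', simplified] ZR_diff
      unfolding cond_mean_at_def by eventually_elim linarith
  qed
  have "AE \<omega> in M. \<forall>i\<in>{1..n}.
      \<bar>?cm i (Y i) t \<omega> - ?cm i (Y i) t' \<omega> - ?cm i (\<lambda>\<omega>. Z i \<omega> - R i \<omega>) t \<omega>\<bar> \<le> 2 * \<gamma> K"
    using unit_bound by (subst AE_ball_countable) (auto intro: countable_finite)
  then show "AE \<omega> in M. \<bar>exposure_contrast M n MC C T Y t t' \<omega> - tau_star \<omega>\<bar> \<le> 2 * \<gamma> K"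
  proof eventually_elim
    case (elim \<omega>)
    let ?a = "\<lambda>i. ?cm i (Y i) t \<omega> - ?cm i (Y i) t' \<omega> - ?cm i (\<lambda>\<omega>. Z i \<omega> - R i \<omega>) t \<omega>"
    have "exposure_contrast M n MC C T Y t t' \<omega> - tau_star \<omega> = 1 / real n * (\<Sum>i=1..n. ?a i)"
      by (simp add: exposure_contrast_def tau_star Z_def R_def N_def sum_subtractf right_diff_distrib
          diff_divide_distrib)
    moreover have "\<bar>\<Sum>i=1..n. ?a i\<bar> \<le> (\<Sum>i=1..n. 2 * \<gamma> K)"
      by (rule order_trans[OF sum_abs sum_mono]) (use elim in auto)
    \<comment> \<open>Scaling by \<open>real n\<close>, positive by \<open>n\<close>, turns the
      average into the sum just bounded; the factor is cancelled afterwards.\<close>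
    ultimately have "real n * \<bar>exposure_contrast M n MC C T Y t t' \<omega> - tau_star \<omega>\<bar> \<le> real n * (2 * \<gamma> K)"
      using n by (simp add: abs_mult)
    then show ?case
      using n by (simp add: mult_le_cancel_left)
  qed
  show "((\<lambda>k. 2 * \<gamma> k) \<longlongrightarrow> 0) at_top"
    using tendsto_mult_right_zero[OF \<gamma>_lim] .
qed

end
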